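(* Let $G\colon\mathbb{R}^3\to\mathbb{R}$ be continuous and such that the system $\dot x(t)=G(p(t),x(t),u(t))$, $x(0)=x^0$, has a control direction $\eta\in\{-1,+1\}$ (in the sense defined in the context). Let $\varphi\colon\mathbb{R}_{\ge 0}\to\mathbb{R}_{\ge 0}$ be a continuously differentiable bijection such that, for some $c_\varphi>0$, $\dot\varphi(t)\le c_\varphi(1+\varphi(t))$ for all $t\ge 0$. Let $$\mathcal{F}:=\{(t,\xi)\in\mathbb{R}_{\ge 0}\times\mathbb{R}\mid \varphi(t)|\xi|<1\},\qquad h\colon\mathcal{F}\to\mathbb{R},\quad h(t,\xi):=\frac{\varphi(t)\,\xi}{1-\varphi(t)|\xi|}.$$ Then for each $x^0\in\mathbb{R}$ and every bounded, continuous $p\colon\mathbb{R}_{\ge 0}\to\mathbb{R}$, the initial-value problem $$\dot x(t)=G\big(p(t),x(t),-\eta h(t,x(t))\big),\qquad x(0)=x^0,$$ on the domain $\mathcal{F}$, has a solution, and every solution has a global extension, i.e. extends to a solution on $\mathbb{R}_{\ge 0}$. Moreover, every global solution $x\colon\mathbb{R}_{\ge 0}\to\mathbb{R}$ is such that $x(t)\to 0$ as $t\to\infty$, and the control function $u\colon\mathbb{R}_{\ge 0}\to\mathbb{R}$, $t\mapsto-\eta h(t,x(t))$, is bounded.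
   Context: Control direction: for continuous $G\colon\mathbb{R}^3\to\mathbb{R}$, a number $\eta\in\{-1,+1\}$ is a control direction for the system $\dot x(t)=G(p(t),x(t),u(t))$ if, for every nonempty compact $K\subset\mathbb{R}\times\mathbb{R}$, there exists $v^*\in(0,1)$ such that the function $$\chi\colon\mathbb{R}\to\mathbb{R},\quad s\mapsto\min\{vG(\rho,\xi,sv)\mid(\rho,\xi)\in K,\ v\in\mathbb{R},\ v^*\le|v|\le 1\}$$ has the property $\sup_{s\ge 0}\chi(\eta s)=+\infty$. Solution: a solution of the initial-value problem is a continuous function $x\colon I\to\mathbb{R}$ on a (nondegenerate) left-closed interval $I\subset\mathbb{R}_{\ge 0}$ with left endpoint $0$, with $x(0)=x^0$, with $\mathrm{graph}(x)=\{(t,x(t))\mid t\in I\}\subset\mathcal{F}$, and satisfying the differential equation on $I$ (one-sided derivative at endpoints belonging to $I$). A global solution is a solution with $I=\mathbb{R}_{\ge 0}$. *)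

theory Defs
  imports "HOL-Analysis.Analysis"
begin

text \<open>
  The minimum is rendered by \<open>LEAST\<close>. In \<open>control_direction\<close> it always exists: \<open>G\<close> is continuous
  there, and \<open>(\<rho>, \<xi>, v)\<close> ranges over a nonempty compact set.
\<close>

definition control_chi ::
    "(real \<times> real \<times> real \<Rightarrow> real) \<Rightarrow> (real \<times> real) set \<Rightarrow> real \<Rightarrow> real \<Rightarrow> real" where
  "control_chi G K v\<^sub>0 s =
     (LEAST y. y \<in> {v * G (\<rho>, \<xi>, s * v) | \<rho> \<xi> v. (\<rho>, \<xi>) \<in> K \<and> v\<^sub>0 \<le> \<bar>v\<bar> \<and> \<bar>v\<bar> \<le> 1})"

definition control_direction :: "(real \<times> real \<times> real \<Rightarrow> real) \<Rightarrow> real \<Rightarrow> bool" where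
  "control_direction G \<eta> \<longleftrightarrow>
     continuous_on UNIV G \<and> \<eta> \<in> {-1, 1} \<and>
     (\<forall>K. compact K \<and> K \<noteq> {} \<longrightarrow>
        (\<exists>v\<^sub>0\<in>{0<..<1}. (SUP s\<in>{0..}. ereal (control_chi G K v\<^sub>0 (\<eta> * s))) = \<infinity>))"

definition funnel :: "(real \<Rightarrow> real) \<Rightarrow> (real \<times> real) set" where
  "funnel \<phi> = {(t, \<xi>). 0 \<le> t \<and> \<phi> t * \<bar>\<xi>\<bar> < 1}"

text \<open>Only the values on \<open>funnel \<phi>\<close> are meaningful.\<close>

definition funnel_gain :: "(real \<Rightarrow> real) \<Rightarrow> real \<times> real \<Rightarrow> real" where
  "funnel_gain \<phi> = (\<lambda>(t, \<xi>). \<phi> t * \<xi> / (1 - \<phi> t * \<bar>\<xi>\<bar>))"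

definition initial_interval :: "real set \<Rightarrow> bool" where
  "initial_interval I \<longleftrightarrow> is_interval I \<and> 0 \<in> I \<and> I \<subseteq> {0..} \<and> I \<noteq> {0}"

text \<open>
  \<open>ivp_solution F f x0 I x\<close>: the restriction of \<open>x\<close> to \<open>I\<close> solves \<open>x' = f (t, x)\<close>, \<open>x 0 = x0\<close>, on
  the domain \<open>F\<close>; values of \<open>x\<close> outside \<open>I\<close> are irrelevant. The derivative within \<open>I\<close> is one-sided
  at the endpoints belonging to \<open>I\<close>.
\<close>

definition ivp_solution ::
    "(real \<times> real) set \<Rightarrow> (real \<times> real \<Rightarrow> real) \<Rightarrow> real \<Rightarrow> real set \<Rightarrow> (real \<Rightarrow> real) \<Rightarrow> bool" where
  "ivp_solution F f x0 I x \<longleftrightarrow>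
     initial_interval I \<and> continuous_on I x \<and> x 0 = x0 \<and>
     (\<lambda>t. (t, x t)) ` I \<subseteq> F \<and>
     (\<forall>t\<in>I. (x has_real_derivative f (t, x t)) (at t within I))"

definition closed_loop ::
    "(real \<times> real \<times> real \<Rightarrow> real) \<Rightarrow> real \<Rightarrow> (real \<Rightarrow> real) \<Rightarrow> (real \<Rightarrow> real) \<Rightarrow> real \<times> real \<Rightarrow> real" where
  "closed_loop G \<eta> \<phi> p = (\<lambda>(t, \<xi>). G (p t, \<xi>, - \<eta> * funnel_gain \<phi> (t, \<xi>)))"

end

theory Submission
  imports Defs "HOL-Complex_Analysis.Great_Picard"
begin

text \<open>
  By the control direction property there are arbitrarily large \<open>s\<close> for which \<open>G\<close>, evaluated at
  the control values \<open>\<mp>\<eta> s\<close>, drives \<open>x\<close> towards \<open>0\<close> faster than any prescribed rate, uniformly in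
  \<open>(p, x)\<close>. On \<open>[a, \<infinity>)\<close> with \<open>a > 0\<close>, such an \<open>s\<close> beats the growth bound on \<open>\<phi>\<close>, so
  \<open>\<phi> \<bar>x\<bar>\<close> cannot cross the level \<open>s / (1 + s)\<close>, at which the gain has modulus \<open>s\<close>; on \<open>[0, a]\<close>
  compactness keeps the solution inside the funnel. Hence the gain is bounded along every solution.
  Such a solution also solves an equation whose right-hand side is clipped outside this level and is
  therefore bounded and continuous on the whole plane. Peano's theorem for the clipped equation
  gives existence, and its solutions, kept inside by the same barrier, continue any given solution
  beyond the end of its interval.
\<close>

section \<open>Peano's theorem for a bounded right-hand side\<close>

lemma has_real_derivative_cong_on:
  assumes "t \<in> S" "\<And>s. s \<in> S \<Longrightarrow> y s = x s" "(x has_real_derivative D) (at t within S)"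
  shows "(y has_real_derivative D) (at t within S)"
  using has_derivative_transform assms unfolding has_field_derivative_def by blast

text \<open>The constant \<open>M\<close> depends on neither the delay nor the iterate, which later
  yields equicontinuity. For \<open>t < 0\<close> the interval \<open>{0..t}\<close> is empty and
  the integral is 0, so the function stays at \<open>x0\<close> and supplies the history read by a
  delayed argument.\<close>

lemma lipschitz_on_integral:
  fixes g :: "real \<Rightarrow> real"
  assumes cont: "continuous_on UNIV g" and bound: "\<And>r. \<bar>g r\<bar> \<le> M"
  shows "M-lipschitz_on UNIV (\<lambda>t. x0 + integral {0..t} g)"
proof -
  have M: "0 \<le> M"
    using bound[of 0] by linarith
  have le: "\<bar>integral {a..b} g\<bar> \<le> M * (b - a)" if "a \<le> b" for a b
    using integral_bound[of a b g M] that bound continuous_on_subset[OF cont] by auto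
  have *: "\<bar>integral {0..t} g - integral {0..s} g\<bar> \<le> M * (t - s)" if "s \<le> t" for s t
  proof (cases "0 \<le> s")
    case True
    have "integral {0..s} g + integral {s..t} g = integral {0..t} g"
      using True that
      by (intro Henstock_Kurzweil_Integration.integral_combine integrable_continuous_real
          continuous_on_subset[OF cont]) auto
    then show ?thesis
      using le[OF that] by linarith
  next
    case False
    show ?thesis
    proof (cases "0 \<le> t")
      case True
      have "M * (t - 0) \<le> M * (t - s)"
        using False M by (intro mult_left_mono) auto
      then show ?thesis
        using False le[OF True] by simp
    next
      case neg: False
      then show ?thesis
        using False M that by simp
    qed
  qed
  show ?thesis
  proof (rule lipschitz_onI[OF _ M])
    fix s t :: real
    show "dist (x0 + integral {0..s} g) (x0 + integral {0..t} g) \<le> M * dist s t"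
      using *[of s t] *[of t s] by (cases "s \<le> t") (auto simp: dist_real_def abs_minus_commute)
  qed
qed

text \<open>The delay makes the Picard iterates stationary on each bounded interval after finitely many
  steps.\<close>

lemma delayed_ode_solution:
  fixes f :: "real \<times> real \<Rightarrow> real"
  assumes cont: "continuous_on UNIV f" and bound: "\<And>z. \<bar>f z\<bar> \<le> M" and "0 < d"
  shows "\<exists>x. M-lipschitz_on UNIV x \<and> x 0 = x0 \<and>
    (\<forall>t\<in>{0..b}. x t = x0 + integral {0..t} (\<lambda>r. f (r, x (r - d))))"
proof -
  define y where "y = rec_nat (\<lambda>t. x0) (\<lambda>_ y t. x0 + integral {0..t} (\<lambda>r. f (r, y (r - d))))"
  have y_Suc: "y (Suc k) t = x0 + integral {0..t} (\<lambda>r. f (r, y k (r - d)))" for k t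
    by (simp add: y_def)
  have y_nonpos: "y k t = x0" if "t \<le> 0" for k t
    using that by (cases k; cases "t = 0") (auto simp: y_def)
  have M: "0 \<le> M"
    using bound[of 0] by linarith
  have lip: "M-lipschitz_on UNIV (y k)" for k
  proof (induction k)
    case 0
    then show ?case
      using M by (simp add: y_def lipschitz_on_def)
  next
    case (Suc k)
    have "continuous_on UNIV (\<lambda>r. f (r, y k (r - d)))"
      by (intro continuous_on_compose2[OF cont] continuous_intros
          continuous_on_compose2[OF lipschitz_on_continuous_on[OF Suc]]) auto
    from lipschitz_on_integral[OF this bound] show ?case
      using y_Suc by presburger
  qed
  have stable: "y (Suc k) t = y k t" if "t \<le> k * d" for k t
    using that
  proof (induction k arbitrary: t)
    case 0
    then show ?case
      by (simp add: y_nonpos)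
  next
    case (Suc k)
    have "integral {0..t} (\<lambda>r. f (r, y (Suc k) (r - d))) = integral {0..t} (\<lambda>r. f (r, y k (r - d)))"
    proof (rule integral_cong)
      fix r assume "r \<in> {0..t}"
      then have "r - d \<le> k * d"
        using Suc.prems by (auto simp: algebra_simps)
      then show "f (r, y (Suc k) (r - d)) = f (r, y k (r - d))"
        using Suc.IH by simp
    qed
    then show ?case
      using y_Suc by metis
  qed
  \<comment> \<open>After \<open>k\<close> steps the iterates are stationary on
    \<open>{0..b}\<close>, so \<open>y k\<close> is a fixed point there.\<close>
  obtain k :: nat where "b / d \<le> k"
    using real_arch_simple by blast
  then have k: "b \<le> k * d"
    using \<open>0 < d\<close> by (simp add: field_simps)
  have "y k t = x0 + integral {0..t} (\<lambda>r. f (r, y k (r - d)))" if "t \<in> {0..b}" for t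
    using stable[of t k] y_Suc[of k t] that k by simp
  then show ?thesis
    using lip y_nonpos[of 0 k] by blast
qed

text \<open>An Arzela-Ascoli argument on the whole line: a diagonal sequence converges at all
  rationals, and the common Lipschitz constant transfers the Cauchy property to every real
  \<open>t\<close>. Pointwise convergence is enough for the dominated convergence used
  afterwards.\<close>

lemma lipschitz_pointwise_convergent_subsequence:
  fixes x :: "nat \<Rightarrow> real \<Rightarrow> real"
  assumes lip: "\<And>n. M-lipschitz_on UNIV (x n)" and init: "\<And>n. x n 0 = x0"
  obtains k X where "strict_mono (k :: nat \<Rightarrow> nat)" "\<And>t. (\<lambda>n. x (k n) t) \<longlonglongrightarrow> X t"
proof -
  have M: "0 \<le> M"
    using lip lipschitz_on_nonneg by blast
  have lipD: "\<bar>x n s - x n t\<bar> \<le> M * \<bar>s - t\<bar>" for n s t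
    using lipschitz_onD[OF lip, of s t n] by (simp add: dist_real_def)
  have "norm (x n q / (1 + \<bar>q\<bar>)) \<le> \<bar>x0\<bar> + M" for n q
  proof -
    have "\<bar>x n q\<bar> \<le> \<bar>x0\<bar> + M * \<bar>q\<bar>"
      using lipD[of n q 0] init[of n] by auto
    also have "\<dots> \<le> (\<bar>x0\<bar> + M) * (1 + \<bar>q\<bar>)"
      using M by (simp add: algebra_simps)
    finally show ?thesis
      by (simp add: field_simps)
  qed
  \<comment> \<open>the weight \<open>1 + \<bar>q\<bar>\<close> supplies the bound, uniform in \<open>q\<close>, that the diagonal argument needs\<close>
  then obtain k where k: "strict_mono (k :: nat \<Rightarrow> nat)"
      and conv: "\<And>q. q \<in> \<rat> \<Longrightarrow> \<exists>l. (\<lambda>n. x (k n) q / (1 + \<bar>q\<bar>)) \<longlonglongrightarrow> l"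
    by (rule function_convergent_subsequence[OF countable_rat, of "\<lambda>n q. x n q / (1 + \<bar>q\<bar>)"]) blast
  have conv': "convergent (\<lambda>n. x (k n) q)" if q: "q \<in> \<rat>" for q
  proof -
    obtain l where "(\<lambda>n. x (k n) q / (1 + \<bar>q\<bar>)) \<longlonglongrightarrow> l"
      using conv[OF q] by blast
    then have "(\<lambda>n. (1 + \<bar>q\<bar>) * (x (k n) q / (1 + \<bar>q\<bar>))) \<longlonglongrightarrow> (1 + \<bar>q\<bar>) * l"
      by (intro tendsto_intros)
    moreover have "(1 + \<bar>q\<bar>) * (x (k n) q / (1 + \<bar>q\<bar>)) = x (k n) q" for n
      by (simp add: add_nonneg_eq_0_iff)
    ultimately show ?thesis
      by (auto simp: convergent_def)
  qed
  have "Cauchy (\<lambda>n. x (k n) t)" for t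
  proof (rule metric_CauchyI)
    fix e :: real assume "0 < e"
    \<comment> \<open>The summand 1 in \<open>M + 1\<close> covers the case
      \<open>M = 0\<close>.\<close>
    define d where "d = e / (3 * (M + 1))"
    have d: "0 < d" "M * d < e / 3"
      using \<open>0 < e\<close> M by (auto simp: d_def field_simps)
    obtain q where q: "q \<in> \<rat>" "t < q" "q < t + d"
      using Rats_dense_in_real[of t "t + d"] d by auto
    have close: "\<bar>x n t - x n q\<bar> < e / 3" for n
    proof -
      have "\<bar>x n t - x n q\<bar> \<le> M * \<bar>t - q\<bar>"
        by (rule lipD)
      also have "\<dots> \<le> M * d"
        using q M by (intro mult_left_mono) auto
      finally show ?thesis
        using d by simp
    qed
    obtain N where N: "\<And>m n. m \<ge> N \<Longrightarrow> n \<ge> N \<Longrightarrow> dist (x (k m) q) (x (k n) q) < e / 3"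
      using metric_CauchyD[OF convergent_Cauchy[OF conv'[OF q(1)]], of "e / 3"] \<open>0 < e\<close> by auto
    have "dist (x (k m) t) (x (k n) t) < e" if "m \<ge> N" "n \<ge> N" for m n
      using N[OF that] close[of "k m"] close[of "k n"] unfolding dist_real_def by linarith
    then show "\<exists>N. \<forall>m\<ge>N. \<forall>n\<ge>N. dist (x (k m) t) (x (k n) t) < e"
      by blast
  qed
  then have "\<exists>l. (\<lambda>n. x (k n) t) \<longlonglongrightarrow> l" for t
    using Cauchy_convergent convergent_def by blast
  then show ?thesis
    using k that by metis
qed

text \<open>Tonelli's scheme: the \<open>n\<close>-th approximation has delay
  \<open>1 / Suc n\<close> and satisfies its equation on \<open>{0..real n}\<close>. Each fixed
  \<open>t\<close> is thus covered from some index on, and dominated convergence with the constant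
  bound \<open>M\<close> passes to the limit under the integral.\<close>

lemma peano_integral_equation:
  fixes f :: "real \<times> real \<Rightarrow> real"
  assumes cont: "continuous_on UNIV f" and bound: "\<And>z. \<bar>f z\<bar> \<le> M"
  shows "\<exists>x. continuous_on UNIV x \<and> (\<forall>t\<ge>0. x t = x0 + integral {0..t} (\<lambda>r. f (r, x r)))"
proof -
  define d where "d n = 1 / real (Suc n)" for n
  have "\<exists>x. M-lipschitz_on UNIV x \<and> x 0 = x0 \<and>
    (\<forall>t\<in>{0..real n}. x t = x0 + integral {0..t} (\<lambda>r. f (r, x (r - d n))))" for n
    by (rule delayed_ode_solution[OF cont bound]) (simp add: d_def)
  then obtain x where lip: "\<And>n. M-lipschitz_on UNIV (x n)" and init: "\<And>n. x n 0 = x0"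
    and x: "\<And>n t. t \<in> {0..real n} \<Longrightarrow> x n t = x0 + integral {0..t} (\<lambda>r. f (r, x n (r - d n)))"
    by metis
  obtain k X where k: "strict_mono (k :: nat \<Rightarrow> nat)" and X: "\<And>t. (\<lambda>n. x (k n) t) \<longlonglongrightarrow> X t"
    by (rule lipschitz_pointwise_convergent_subsequence[of M x x0]) (use lip init in auto)
  have M: "0 \<le> M"
    using lip lipschitz_on_nonneg by blast
  have lipD: "\<bar>x n s - x n t\<bar> \<le> M * \<bar>s - t\<bar>" for n s t
    using lipschitz_onD[OF lip, of s t n] by (simp add: dist_real_def)
  have "M-lipschitz_on UNIV X"
  proof (rule lipschitz_onI[OF _ M])
    fix s t :: real
    have "(\<lambda>n. \<bar>x (k n) s - x (k n) t\<bar>) \<longlonglongrightarrow> \<bar>X s - X t\<bar>"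
      by (intro tendsto_intros X)
    then have "\<bar>X s - X t\<bar> \<le> M * \<bar>s - t\<bar>"
      by (rule LIMSEQ_le_const2) (use lipD in blast)
    then show "dist (X s) (X t) \<le> M * dist s t"
      by (simp add: dist_real_def)
  qed
  then have contX: "continuous_on UNIV X"
    by (rule lipschitz_on_continuous_on)
  have d0: "(\<lambda>n. d (k n)) \<longlonglongrightarrow> 0"
    unfolding d_def
    using LIMSEQ_subseq_LIMSEQ[OF LIMSEQ_Suc[OF lim_1_over_n] k] by (simp add: o_def)
  \<comment> \<open>The common Lipschitz constant bounds the effect of the delay by
    \<open>M * \<bar>d (k n)\<bar>\<close>, which vanishes in the limit.\<close>
  have delayed: "(\<lambda>n. x (k n) (r - d (k n))) \<longlonglongrightarrow> X r" for r
  proof -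
    have "(\<lambda>n. x (k n) (r - d (k n)) - x (k n) r) \<longlonglongrightarrow> 0"
    proof (rule Lim_null_comparison)
      show "\<forall>\<^sub>F n in sequentially. norm (x (k n) (r - d (k n)) - x (k n) r) \<le> M * \<bar>d (k n)\<bar>"
        using lipD[of _ "r - d _" r] by auto
      show "(\<lambda>n. M * \<bar>d (k n)\<bar>) \<longlonglongrightarrow> 0"
        using tendsto_mult_right_zero[OF tendsto_rabs_zero[OF d0]] by blast
    qed
    from tendsto_add[OF this X[of r]] show ?thesis
      by simp
  qed
  have "X t = x0 + integral {0..t} (\<lambda>r. f (r, X r))" if "0 \<le> t" for t
  proof -
    have lim: "(\<lambda>n. integral {0..t} (\<lambda>r. f (r, x (k n) (r - d (k n)))))
        \<longlonglongrightarrow> integral {0..t} (\<lambda>r. f (r, X r))"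
    proof (rule dominated_convergence(2)[where h = "\<lambda>_. M"])
      fix n
      show "(\<lambda>r. f (r, x (k n) (r - d (k n)))) integrable_on {0..t}"
        by (intro integrable_continuous_real continuous_on_compose2[OF cont] continuous_intros
            continuous_on_compose2[OF lipschitz_on_continuous_on[OF lip]]) auto
    next
      fix r
      have "isCont f (r, X r)"
        using cont by (simp add: continuous_on_eq_continuous_at)
      then show "(\<lambda>n. f (r, x (k n) (r - d (k n)))) \<longlonglongrightarrow> f (r, X r)"
        by (rule isCont_tendsto_compose) (intro tendsto_intros delayed)
    qed (use bound in auto)
    have "\<forall>\<^sub>F n in sequentially. t \<le> real n"
      by (rule eventually_sequentiallyI[of "nat \<lceil>t\<rceil>"]) linarith
    then have "\<forall>\<^sub>F n in sequentially. t \<le> real (k n)"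
      using eventually_subseq[OF k] by blast
    then have "\<forall>\<^sub>F n in sequentially.
        x0 + integral {0..t} (\<lambda>r. f (r, x (k n) (r - d (k n)))) = x (k n) t"
      by eventually_elim (use x \<open>0 \<le> t\<close> in simp)
    moreover have "(\<lambda>n. x0 + integral {0..t} (\<lambda>r. f (r, x (k n) (r - d (k n)))))
        \<longlonglongrightarrow> x0 + integral {0..t} (\<lambda>r. f (r, X r))"
      by (rule tendsto_add[OF tendsto_const lim])
    ultimately have "(\<lambda>n. x (k n) t) \<longlonglongrightarrow> x0 + integral {0..t} (\<lambda>r. f (r, X r))"
      by (rule Lim_transform_eventually[rotated])
    then show ?thesis
      using LIMSEQ_unique X by blast
  qed
  then show ?thesis
    using contX by blast
qed

lemma at_within_atLeast_eq_Icc: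
  fixes t b :: real
  assumes "t < b"
  shows "at t within {a..} = at t within {a..b}"
  by (rule at_within_nhd[where S = "{..<b}"]) (use assms in auto)

text \<open>Translation in time reduces the start \<open>a\<close> to 0, and the fundamental theorem
  of calculus differentiates the integral equation. The bound on \<open>f\<close> is what makes the
  solution exist on the entire half-line.\<close>

theorem peano_bounded:
  fixes f :: "real \<times> real \<Rightarrow> real"
  assumes cont: "continuous_on UNIV f" and bound: "\<And>z. \<bar>f z\<bar> \<le> M"
  obtains x where "x a = x0"
    "\<And>t. a \<le> t \<Longrightarrow> (x has_real_derivative f (t, x t)) (at t within {a..})"
proof -
  have cont': "continuous_on UNIV (\<lambda>z. f (fst z + a, snd z))"
    by (intro continuous_on_compose2[OF cont] continuous_intros) auto
  obtain y where conty: "continuous_on UNIV y"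
    and y: "\<And>t. 0 \<le> t \<Longrightarrow> y t = x0 + integral {0..t} (\<lambda>r. f (r + a, y r))"
    using peano_integral_equation[OF cont', of M x0] bound by auto
  have der: "(y has_real_derivative f (t + a, y t)) (at t within {0..})" if "0 \<le> t" for t
  proof -
    \<comment> \<open>The right end \<open>t + 1\<close> lies strictly beyond \<open>t\<close>, so
      that differentiating within this compact interval is the same as within
      \<open>{0..}\<close>.\<close>
    have "continuous_on {0..t + 1} (\<lambda>r. f (r + a, y r))"
      by (intro continuous_on_compose2[OF cont] continuous_intros continuous_on_subset[OF conty]) auto
    from integral_has_real_derivative[OF this, of t]
    have "((\<lambda>s. x0 + integral {0..s} (\<lambda>r. f (r + a, y r))) has_real_derivative f (t + a, y t))
        (at t within {0..t + 1})"
      using that DERIV_cmult by (auto intro!: derivative_eq_intros)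
    then have "((\<lambda>s. x0 + integral {0..s} (\<lambda>r. f (r + a, y r))) has_real_derivative f (t + a, y t))
        (at t within {0..})"
      using at_within_atLeast_eq_Icc[of t "t + 1"] by simp
    then show ?thesis
      by (rule has_real_derivative_cong_on[rotated 2]) (use that y in auto)
  qed
  show ?thesis
  proof (rule that[of "\<lambda>t. y (t - a)"])
    show "y (a - a) = x0"
      using y[of 0] by simp
    fix t assume "a \<le> t"
    have "(\<lambda>s. s - a) ` {a..} = {0..}"
      by (auto simp: image_iff intro!: bexI[of _ "_ + a"])
    then have "(y has_real_derivative f (t - a + a, y (t - a))) (at (t - a) within (\<lambda>s. s - a) ` {a..})"
      using der[of "t - a"] \<open>a \<le> t\<close> by simp
    moreover have "((\<lambda>s. s - a) has_real_derivative 1) (at t within {a..})"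
      by (auto intro!: derivative_eq_intros)
    ultimately have "(y \<circ> (\<lambda>s. s - a) has_real_derivative f (t - a + a, y (t - a)) * 1) (at t within {a..})"
      by (rule DERIV_image_chain)
    then show "((\<lambda>t. y (t - a)) has_real_derivative f (t, y (t - a))) (at t within {a..})"
      by (simp add: o_def)
  qed
qed

section \<open>Endpoint derivatives, gluing and a first-crossing argument\<close>

text \<open>Provides the one-sided derivative at an endpoint newly added to a solution's interval:
  \<open>x\<close> minus an antiderivative of \<open>g\<close> has zero derivative inside, hence is
  constant up to the ends by continuity.\<close>

lemma has_real_derivative_Icc:
  fixes x g :: "real \<Rightarrow> real"
  assumes "a < b" and contg: "continuous_on {a..b} g" and contx: "continuous_on {a..b} x"
    and der: "\<And>t. a < t \<Longrightarrow> t < b \<Longrightarrow> (x has_real_derivative g t) (at t)"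
    and t: "t \<in> {a..b}"
  shows "(x has_real_derivative g t) (at t within {a..b})"
proof -
  define F where "F t = integral {a..t} g" for t
  have F: "(F has_real_derivative g t) (at t within {a..b})" if "t \<in> {a..b}" for t
    unfolding F_def by (rule integral_has_real_derivative[OF contg that])
  have contF: "continuous_on {a..b} F"
    using F DERIV_continuous_on by blast
  have const: "x t - F t = x a - F a" if "t \<in> {a..b}" for t
  proof (rule DERIV_isconst2[OF \<open>a < b\<close>])
    show "continuous_on {a..b} (\<lambda>t. x t - F t)"
      by (intro continuous_intros contx contF)
    fix s assume s: "a < s" "s < b"
    then have "(F has_real_derivative g s) (at s)"
      using F[of s] at_within_Icc_at[of a s b] by simp
    from DERIV_diff[OF der[OF s] this] show "((\<lambda>t. x t - F t) has_real_derivative 0) (at s)"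
      by simp
  qed (use that in auto)
  have "((\<lambda>t. F t + (x a - F a)) has_real_derivative g t) (at t within {a..b})"
    using F[OF t] by (auto intro!: derivative_eq_intros)
  then show ?thesis
    by (rule has_real_derivative_cong_on[rotated 2]) (use t const in \<open>auto simp: algebra_simps\<close>)
qed

text \<open>At the junction \<open>b\<close> both pieces have the one-sided derivative
  \<open>f (b, x b)\<close>, because \<open>x b = z b\<close>.\<close>

lemma has_real_derivative_glue:
  fixes x z :: "real \<Rightarrow> real"
  assumes "a \<le> b" "x b = z b"
    and x: "\<And>t. t \<in> {a..b} \<Longrightarrow> (x has_real_derivative f (t, x t)) (at t within {a..b})"
    and z: "\<And>t. b \<le> t \<Longrightarrow> (z has_real_derivative f (t, z t)) (at t within {b..})"
    and y: "y = (\<lambda>t. if t \<le> b then x t else z t)"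
    and t: "a \<le> t"
  shows "(y has_real_derivative f (t, y t)) (at t within {a..})"
proof -
  have yx: "y t = x t" if "t \<in> {a..b}" for t
    using that y by simp
  have yz: "y t = z t" if "t \<in> {b..}" for t
    using that y assms(2) by auto
  have left: "(y has_real_derivative f (t, y t)) (at t within {a..b})" if "t \<in> {a..b}" for t
    using has_real_derivative_cong_on[OF that yx x[OF that]] yx[OF that] by simp
  have right: "(y has_real_derivative f (t, y t)) (at t within {b..})" if "t \<in> {b..}" for t
    using has_real_derivative_cong_on[OF that yz z[of t]] yz[OF that] that by simp
  consider "t < b" | "b < t" | "t = b" by linarith
  then show ?thesis
  proof cases
    case 1
    then show ?thesis
      using left[of t] t at_within_atLeast_eq_Icc[of t b] by simp
  next
    case 2
    have "at t within {a..} = at t within {b..}"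
      by (rule at_within_nhd[where S = "{b<..}"]) (use 2 assms in auto)
    then show ?thesis
      using right[of t] 2 by simp
  next
    case 3
    have "{a..} = {a..b} \<union> {b..}"
      using assms(1) by auto
    then show ?thesis
      using left[of t] right[of t] 3 assms(1)
      by (auto simp: has_field_derivative_iff Lim_within_Un)
  qed
qed

text \<open>At the first time \<open>t0\<close> with \<open>w t0 = m\<close>, a negative derivative
  would force values above \<open>m\<close> just before \<open>t0\<close>, yet \<open>w\<close> is
  below \<open>m\<close> there. The sign of \<open>D\<close> matters at the level itself, so nothing
  is asked of the equation away from it.\<close>

lemma derivative_barrier:
  fixes w :: "real \<Rightarrow> real"
  assumes der: "\<And>t. t \<in> {a..b} \<Longrightarrow> (w has_real_derivative D t) (at t within {a..b})"
    and neg: "\<And>t. t \<in> {a..b} \<Longrightarrow> w t = m \<Longrightarrow> D t < 0"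
    and init: "w a < m" and t: "t \<in> {a..b}"
  shows "w t < m"
proof (rule ccontr)
  assume "\<not> w t < m"
  have cont: "continuous_on {a..t} w"
    using DERIV_continuous_on[OF der] by (rule continuous_on_subset) (use t in auto)
  define S where "S = {s \<in> {a..t}. w s = m}"
  have "S \<noteq> {}"
    using IVT'[of w a m t] init t cont \<open>\<not> w t < m\<close> by (auto simp: S_def)
  moreover have "closed S"
    unfolding S_def by (rule continuous_closed_preimage_constant[OF cont]) simp
  moreover have bdd: "bdd_below S"
    by (auto simp: S_def)
  ultimately have "Inf S \<in> S"
    by (simp add: closed_contains_Inf)
  then obtain t0 where t0: "t0 = Inf S" "a \<le> t0" "t0 \<le> t" "w t0 = m"
    by (auto simp: S_def)
  then have "a < t0"
    using init by (cases "a = t0") auto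
  have below: "w s < m" if "a \<le> s" "s < t0" for s
  proof (rule ccontr)
    assume "\<not> w s < m"
    moreover have "continuous_on {a..s} w"
      by (rule continuous_on_subset[OF cont]) (use that t0 in auto)
    ultimately obtain r where "a \<le> r" "r \<le> s" "w r = m"
      using IVT'[of w a m s] init \<open>a \<le> s\<close> by auto
    then have "r \<in> S"
      using that t0 by (simp add: S_def)
    then show False
      using cInf_lower[OF _ bdd] \<open>r \<le> s\<close> that t0 by force
  qed
  have "t0 \<in> {a..b}"
    using t0 t by auto
  from has_real_derivative_neg_dec_left[OF der[OF this] neg[OF this \<open>w t0 = m\<close>]]
  obtain d where d: "0 < d"
      "\<And>h. 0 < h \<Longrightarrow> t0 - h \<in> {a..b} \<Longrightarrow> h < d \<Longrightarrow> w t0 < w (t0 - h)"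
    by blast
  \<comment> \<open>The minimum with \<open>t0 - a\<close> keeps \<open>t0 - h\<close> in
    \<open>{a..b}\<close>, and halving \<open>d\<close> makes \<open>h < d\<close> strict.\<close>
  define h where "h = min (d / 2) (t0 - a)"
  have "0 < h" "h < d" "h \<le> t0 - a"
    using d(1) \<open>a < t0\<close> by (auto simp: h_def min_def)
  then show False
    using d(2)[of h] below[of "t0 - h"] t0 t by auto
qed

section \<open>The funnel barrier\<close>

text \<open>\<open>LEAST\<close> on the reals is meaningful when the minimum is attained; here the
  set of values is a continuous image of a compact set.\<close>

lemma control_chi_le:
  assumes contG: "continuous_on UNIV G" and K: "compact K" and "(\<rho>, \<xi>) \<in> K"
    and v: "v0 \<le> \<bar>v\<bar>" "\<bar>v\<bar> \<le> 1"
  shows "control_chi G K v0 s \<le> v * G (\<rho>, \<xi>, s * v)"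
proof -
  define A where "A = {v * G (\<rho>, \<xi>, s * v) | \<rho> \<xi> v. (\<rho>, \<xi>) \<in> K \<and> v0 \<le> \<bar>v\<bar> \<and> \<bar>v\<bar> \<le> 1}"
  define V where "V = {v::real. v0 \<le> \<bar>v\<bar> \<and> \<bar>v\<bar> \<le> 1}"
  have "V = {-1..1} \<inter> {v. v0 \<le> \<bar>v\<bar>}"
    by (auto simp: V_def)
  moreover have "closed {v::real. v0 \<le> \<bar>v\<bar>}"
    by (intro closed_Collect_le continuous_intros)
  ultimately have "compact V"
    by (simp add: compact_Int_closed)
  have A: "A = (\<lambda>((\<rho>, \<xi>), v). v * G (\<rho>, \<xi>, s * v)) ` (K \<times> V)"
    by (force simp: A_def V_def image_iff)
  have "compact A"
    unfolding A case_prod_unfold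
    by (intro compact_continuous_image compact_Times K \<open>compact V\<close> continuous_intros
        continuous_on_compose2[OF contG]) auto
  moreover have mem: "v * G (\<rho>, \<xi>, s * v) \<in> A"
    using assms unfolding A_def by blast
  ultimately obtain y where y: "y \<in> A" "\<And>z. z \<in> A \<Longrightarrow> y \<le> z"
    using compact_attains_inf[of A] by blast
  then have "control_chi G K v0 s = y"
    unfolding control_chi_def A_def by (intro Least_equality)
  then show ?thesis
    using y mem by simp
qed

text \<open>The two inequalities come from \<open>v = -1\<close> and \<open>v = 1\<close> in the
  minimum defining \<open>control_chi\<close>. One \<open>s\<close> serves all of \<open>K\<close>,
  and it can be taken beyond any \<open>S\<close>.\<close>

lemma control_direction_levels:
  assumes dir: "control_direction G \<eta>" and K: "compact K"
  obtains s where "S < s"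
    "\<And>\<rho> \<xi>. (\<rho>, \<xi>) \<in> K \<Longrightarrow> G (\<rho>, \<xi>, - \<eta> * s) < - B"
    "\<And>\<rho> \<xi>. (\<rho>, \<xi>) \<in> K \<Longrightarrow> B < G (\<rho>, \<xi>, \<eta> * s)"
proof (cases "K = {}")
  case True
  then show ?thesis
    using that[of "S + 1"] by simp
next
  case False
  have contG: "continuous_on UNIV G" and \<eta>: "\<bar>\<eta>\<bar> = 1"
    using dir by (auto simp: control_direction_def)
  obtain v0 where v0: "0 < v0" "v0 < 1"
    and sup: "(SUP s\<in>{0..}. ereal (control_chi G K v0 (\<eta> * s))) = \<infinity>"
    using dir K False unfolding control_direction_def by (meson greaterThanLessThan_iff)
  obtain \<rho>0 \<xi>0 where K0: "(\<rho>0, \<xi>0) \<in> K"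
    using False by auto
  \<comment> \<open>The bound \<open>m\<close> on controls of modulus at most
    \<open>\<bar>S\<bar>\<close> forces \<open>s\<close> to be large: if \<open>s \<le> S\<close>,
    then \<open>G\<close> at \<open>(\<rho>0, \<xi>0, \<eta> * s)\<close> could not exceed
    \<open>m\<close>.\<close>
  have "compact ((\<lambda>u. G (\<rho>0, \<xi>0, u)) ` {-\<bar>S\<bar>..\<bar>S\<bar>})"
    by (intro compact_continuous_image continuous_on_compose2[OF contG] continuous_intros) auto
  then obtain m where m: "\<And>u. u \<in> {-\<bar>S\<bar>..\<bar>S\<bar>} \<Longrightarrow> \<bar>G (\<rho>0, \<xi>0, u)\<bar> \<le> m"
    using compact_imp_bounded bounded_iff by (metis imageI real_norm_def)
  have "ereal (max B m) < (SUP s\<in>{0..}. ereal (control_chi G K v0 (\<eta> * s)))"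
    by (simp add: sup max_def)
  then obtain s where s: "0 \<le> s" "max B m < control_chi G K v0 (\<eta> * s)"
    by (auto simp: less_SUP_iff)
  have pos: "max B m < G (\<rho>, \<xi>, \<eta> * s)" and neg: "G (\<rho>, \<xi>, - \<eta> * s) < - max B m"
    if "(\<rho>, \<xi>) \<in> K" for \<rho> \<xi>
    using control_chi_le[OF contG K that, of v0 1 "\<eta> * s"]
      control_chi_le[OF contG K that, of v0 "-1" "\<eta> * s"] s v0 by auto
  have "S < s"
  proof (rule ccontr)
    assume "\<not> S < s"
    then have "\<bar>\<eta> * s\<bar> \<le> \<bar>S\<bar>"
      using s \<eta> by (simp add: abs_mult)
    then have "\<bar>G (\<rho>0, \<xi>0, \<eta> * s)\<bar> \<le> m"
      by (intro m) auto
    then show False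
      using pos[OF K0] by linarith
  qed
  then show ?thesis
    using that[of s] pos neg by (smt (verit))
qed

section \<open>The gain as a function of one variable, and clipping\<close>

text \<open>A homeomorphism of (-1, 1) onto the reals with inverse
  \<open>s / (1 + \<bar>s\<bar>)\<close>; this is the origin of the level
  \<open>s / (1 + s)\<close>.\<close>

definition gain :: "real \<Rightarrow> real" where
  "gain w = w / (1 - \<bar>w\<bar>)"

definition clip :: "real \<Rightarrow> real \<Rightarrow> real" where
  "clip r x = max (- r) (min r x)"

lemma funnel_gain_eq: "0 \<le> \<phi> t \<Longrightarrow> funnel_gain \<phi> (t, \<xi>) = gain (\<phi> t * \<xi>)"
  by (simp add: funnel_gain_def gain_def abs_mult)

lemma gain_level:
  assumes "0 < s"
  shows "gain (s / (1 + s)) = s" "gain (- (s / (1 + s))) = - s"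
  using assms by (auto simp: gain_def field_simps)

lemma abs_gain_le:
  assumes "0 < s" "\<bar>w\<bar> \<le> s / (1 + s)"
  shows "\<bar>gain w\<bar> \<le> s"
proof -
  have "s / (1 + s) < 1"
    using assms by simp
  then have "\<bar>w\<bar> < 1"
    using assms by linarith
  then show ?thesis
    using assms by (simp add: gain_def abs_div field_simps)
qed

text \<open>Turns the choice of a large \<open>s\<close> into the strict initial condition of the
  barrier, by monotonicity of the inverse of the gain.\<close>

lemma less_level:
  fixes w s :: real
  assumes "0 \<le> w" "w < 1" "w / (1 - w) < s"
  shows "w < s / (1 + s)"
proof -
  have "0 < s"
    using assms by (smt (verit) divide_nonneg_pos)
  then show ?thesis
    using assms by (simp add: field_simps)
qed

lemma abs_clip_le: "0 \<le> r \<Longrightarrow> \<bar>clip r x\<bar> \<le> r"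
  by (auto simp: clip_def)

lemma clip_eq: "\<bar>x\<bar> \<le> r \<Longrightarrow> clip r x = x"
  by (auto simp: clip_def)

lemma continuous_on_clip [continuous_intros]:
  "continuous_on S f \<Longrightarrow> continuous_on S (\<lambda>z. clip r (f z))"
  unfolding clip_def by (intro continuous_intros)

section \<open>The closed loop and the function \<open>\<phi>\<close>\<close>

locale funnel_control =
  fixes G :: "real \<times> real \<times> real \<Rightarrow> real"
    and \<eta> c :: real
    and \<phi> \<phi>' p :: "real \<Rightarrow> real"
  assumes dir: "control_direction G \<eta>"
    and bij: "bij_betw \<phi> {0..} {0..}"
    and deriv: "\<And>t. t \<ge> 0 \<Longrightarrow> (\<phi> has_real_derivative \<phi>' t) (at t within {0..})"
    and c_pos: "c > 0"
    and growth: "\<And>t. t \<ge> 0 \<Longrightarrow> \<phi>' t \<le> c * (1 + \<phi> t)"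
    and contp: "continuous_on {0..} p"
    and bddp: "bounded (p ` {0..})"
begin

lemma contG: "continuous_on UNIV G" and eta: "\<bar>\<eta>\<bar> = 1"
  using dir by (auto simp: control_direction_def)

lemma cont_phi: "continuous_on {0..} \<phi>"
  using deriv DERIV_continuous_on by (metis atLeast_iff)

lemma phi_nonneg: "0 \<le> t \<Longrightarrow> 0 \<le> \<phi> t"
  using bij by (force simp: bij_betw_def)

text \<open>A continuous injection on an interval is strictly monotone, and a decreasing
  \<open>\<phi>\<close> could not attain the value \<open>\<phi> 0 + 1\<close>.\<close>

lemma phi_strict_mono: "strict_mono_on {0..} \<phi>"
proof -
  have "strict_mono_on {0..} \<phi> \<or> strict_antimono_on {0..} \<phi>"
    using bij cont_phi injective_eq_monotone_map[of "{0..}" \<phi>]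
    by (auto simp: bij_betw_def is_interval_1)
  moreover have "\<not> strict_antimono_on {0..} \<phi>"
  proof
    assume anti: "strict_antimono_on {0..} \<phi>"
    obtain t where "0 \<le> t" "\<phi> t = \<phi> 0 + 1"
      using bij phi_nonneg[of 0] unfolding bij_betw_def
      by (metis add_nonneg_nonneg atLeast_iff imageE order_refl zero_le_one)
    then show False
      using monotone_onD[OF anti, of 0 t] by (cases "t = 0") auto
  qed
  ultimately show ?thesis
    by blast
qed

text \<open>At time 0 the funnel therefore leaves the state unrestricted, so every \<open>x0\<close>
  is admissible. It is also the reason why the barrier has to start at a positive time.\<close>

lemma phi_0: "\<phi> 0 = 0"
proof -
  obtain t where t: "0 \<le> t" "\<phi> t = 0"
    using bij unfolding bij_betw_def by (metis atLeast_iff imageE order_refl)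
  then show ?thesis
    using strict_mono_onD[OF phi_strict_mono, of 0 t] phi_nonneg[of 0] by (cases "t = 0") auto
qed

lemma phi_pos: "0 < t \<Longrightarrow> 0 < \<phi> t"
  using strict_mono_onD[OF phi_strict_mono, of 0 t] phi_0 by simp

lemma phi_mono: "0 \<le> s \<Longrightarrow> s \<le> t \<Longrightarrow> \<phi> s \<le> \<phi> t"
  using strict_mono_onD[OF phi_strict_mono, of s t] by (cases "s = t") auto

lemma phi_at_top: "filterlim \<phi> at_top at_top"
proof (rule filterlim_at_top[THEN iffD2], rule allI)
  fix Z :: real
  obtain t where t: "0 \<le> t" "\<phi> t = max 0 Z"
    using bij unfolding bij_betw_def by (metis atLeast_iff imageE max.cobounded1)
  have "Z \<le> \<phi> s" if "t \<le> s" for s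
    using phi_mono[OF t(1) that] t by simp
  then show "\<forall>\<^sub>F s in at_top. Z \<le> \<phi> s"
    using eventually_at_top_linorder by blast
qed

text \<open>Where the gain equals \<open>\<plusminus>s\<close>, the control term outweighs the growth of \<open>\<phi>\<close>, so that
  \<open>\<phi> \<bar>x\<bar>\<close> cannot cross the corresponding level \<open>s / (1 + s)\<close>.\<close>

lemma funnel_barrier:
  assumes "0 < a"
  obtains s where "H < s" "0 < s"
    "\<And>b x D t. \<lbrakk>\<And>t. t \<in> {a..b} \<Longrightarrow> (x has_real_derivative D t) (at t within {a..b});
        \<And>t. t \<in> {a..b} \<Longrightarrow> \<phi> t * \<bar>x t\<bar> = s / (1 + s) \<Longrightarrow> D t = closed_loop G \<eta> \<phi> p (t, x t);
        \<phi> a * \<bar>x a\<bar> < s / (1 + s); t \<in> {a..b}\<rbrakk> \<Longrightarrow> \<phi> t * \<bar>x t\<bar> < s / (1 + s)"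
proof -
  define q where "q = \<phi> a"
  have q: "0 < q"
    using phi_pos assms by (simp add: q_def)
  obtain P where P: "\<And>t. 0 \<le> t \<Longrightarrow> \<bar>p t\<bar> \<le> P"
    using bddp bounded_iff by (metis atLeast_iff imageI real_norm_def)
  \<comment> \<open>At the level, \<open>x t\<close> is \<open>m / \<phi> t\<close> up to sign with
    \<open>m < 1\<close>. The growth bound and \<open>\<phi> t \<ge> q\<close> then give
    \<open>\<phi>' t * (m / \<phi> t) \<le> \<phi> t * B\<close>, so a speed beyond \<open>B\<close>
    towards 0 suffices.\<close>
  define B where "B = c * (1 / q\<^sup>2 + 1 / q)"
  \<comment> \<open>The box contains all pairs \<open>(p t, x t)\<close> at the level, because
    \<open>\<phi> t \<ge> q\<close> gives \<open>\<bar>x t\<bar> \<le> 1 / q\<close> there.\<close>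
  obtain s where s: "max H 0 < s"
    and neg: "\<And>\<rho> \<xi>. (\<rho>, \<xi>) \<in> {-P..P} \<times> {-(1/q)..1/q} \<Longrightarrow> G (\<rho>, \<xi>, - \<eta> * s) < - B"
    and pos: "\<And>\<rho> \<xi>. (\<rho>, \<xi>) \<in> {-P..P} \<times> {-(1/q)..1/q} \<Longrightarrow> B < G (\<rho>, \<xi>, \<eta> * s)"
    by (rule control_direction_levels[OF dir, of "{-P..P} \<times> {-(1/q)..1/q}" "max H 0" B])
      (auto intro: compact_Times)
  define m where "m = s / (1 + s)"
  have m: "0 < m" "m < 1"
    using s by (auto simp: m_def)
  \<comment> \<open>With \<open>g\<close> the derivative of \<open>\<bar>x\<bar>\<close> at the
    level, the expression is the derivative of \<open>\<phi> * \<bar>x\<bar>\<close>.\<close>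
  have key: "\<phi>' t * (m / \<phi> t) + \<phi> t * g < 0" if "a \<le> t" "g < - B" for t g
  proof -
    have r: "q \<le> \<phi> t" "0 < \<phi> t"
      using phi_mono[of a t] phi_pos[of t] assms that by (auto simp: q_def)
    have "\<phi>' t * (m / \<phi> t) \<le> c * (1 + \<phi> t) * (m / \<phi> t)"
      using growth[of t] assms that m r by (intro mult_right_mono) auto
    also have "\<dots> \<le> c * (1 + \<phi> t) * (1 / \<phi> t)"
      using m r c_pos by (intro mult_left_mono divide_right_mono) auto
    also have "\<dots> = \<phi> t * (c * (1 / (\<phi> t)\<^sup>2 + 1 / \<phi> t))"
      using r by (simp add: field_simps power2_eq_square)
    also have "\<dots> \<le> \<phi> t * B"
      unfolding B_def using r q c_pos
      by (intro mult_left_mono add_mono divide_left_mono power_mono) auto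
    also have "\<dots> < \<phi> t * (- g)"
      using r that by (intro mult_strict_left_mono) auto
    finally show ?thesis
      by simp
  qed
  show ?thesis
  proof (rule that[of s])
    \<comment> \<open>The level is fixed before \<open>x\<close> and \<open>D\<close>. As
      \<open>D\<close> is tied to the closed loop at the level alone, the barrier also applies to
      the clipped equation.\<close>
    fix b x D t
    assume der: "\<And>t. t \<in> {a..b} \<Longrightarrow> (x has_real_derivative D t) (at t within {a..b})"
      and D: "\<And>t. t \<in> {a..b} \<Longrightarrow> \<phi> t * \<bar>x t\<bar> = s / (1 + s) \<Longrightarrow> D t = closed_loop G \<eta> \<phi> p (t, x t)"
      and init: "\<phi> a * \<bar>x a\<bar> < s / (1 + s)" and t: "t \<in> {a..b}"
    have der_w: "((\<lambda>t. \<phi> t * x t) has_real_derivative \<phi>' t * x t + \<phi> t * D t) (at t within {a..b})"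
      if "t \<in> {a..b}" for t
    proof -
      have "(\<phi> has_real_derivative \<phi>' t) (at t within {a..b})"
        by (rule DERIV_subset[OF deriv]) (use that assms in auto)
      from DERIV_mult[OF this der[OF that]] show ?thesis
        by (simp add: algebra_simps)
    qed
    have K: "(p t, x t) \<in> {-P..P} \<times> {-(1/q)..1/q}" if "t \<in> {a..b}" "\<phi> t * \<bar>x t\<bar> = m" for t
    proof -
      have "q * \<bar>x t\<bar> \<le> \<phi> t * \<bar>x t\<bar>"
        using phi_mono[of a t] assms that by (intro mult_right_mono) (auto simp: q_def)
      then have "q * \<bar>x t\<bar> \<le> 1"
        using that m by simp
      then have "\<bar>x t\<bar> \<le> 1 / q"
        using q by (simp add: field_simps)
      moreover have "\<bar>p t\<bar> \<le> P"
        using P that assms by simp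
      ultimately show ?thesis
        by (auto simp: abs_le_iff)
    qed
    have "\<phi> t * x t < m"
    proof (rule derivative_barrier[OF der_w _ _ t])
      show "\<phi> a * x a < m"
        using init assms phi_pos[of a] by (smt (verit) m_def mult_left_mono)
    next
      fix t assume t: "t \<in> {a..b}" and eq: "\<phi> t * x t = m"
      have r: "0 < \<phi> t"
        using phi_pos t assms by simp
      then have x: "x t = m / \<phi> t"
        using eq by (auto simp: field_simps)
      then have "0 \<le> x t"
        using m r by simp
      then have abs: "\<phi> t * \<bar>x t\<bar> = m"
        using eq by simp
      have "D t = G (p t, x t, - \<eta> * s)"
        using D[OF t] abs gain_level(1)[of s] s eq r
        by (simp add: closed_loop_def funnel_gain_eq m_def)
      then have "D t < - B"
        using neg K[OF t abs] by simp
      then show "\<phi>' t * x t + \<phi> t * D t < 0"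
        using key[of t "D t"] t x by simp
    qed
    \<comment> \<open>The mirror image: the gain is now \<open>- s\<close>, the control is
      \<open>\<eta> * s\<close>, and the second inequality for \<open>G\<close> applies.\<close>
    moreover have "- (\<phi> t * x t) < m"
    proof (rule derivative_barrier[OF DERIV_minus[OF der_w] _ _ t])
      show "- (\<phi> a * x a) < m"
        using init assms phi_pos[of a]
        by (smt (verit) m_def mult_left_mono mult_minus_right)
    next
      fix t assume t: "t \<in> {a..b}" and eq: "- (\<phi> t * x t) = m"
      have r: "0 < \<phi> t"
        using phi_pos t assms by simp
      then have x: "- x t = m / \<phi> t"
        using eq m by (auto simp: field_simps)
      then have "0 \<le> - x t"
        using m r by simp
      then have abs: "\<phi> t * \<bar>x t\<bar> = m"
        using eq by simp
      have "\<phi> t * x t = - m"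
        using eq by simp
      then have "D t = G (p t, x t, \<eta> * s)"
        using D[OF t] abs gain_level(2)[of s] s r
        by (simp add: closed_loop_def funnel_gain_eq m_def)
      then have "- D t < - B"
        using pos K[OF t abs] by simp
      then have "\<phi>' t * (- x t) + \<phi> t * (- D t) < 0"
        using key[of t "- D t"] t x by simp
      then show "- (\<phi>' t * x t + \<phi> t * D t) < 0"
        by simp
    qed
    moreover have "0 < \<phi> t"
      using phi_pos t assms by simp
    ultimately show "\<phi> t * \<bar>x t\<bar> < s / (1 + s)"
      by (cases "0 \<le> x t") (auto simp: m_def)
  qed (use s in auto)
qed


section \<open>A level for each solution, and the clipped equation\<close>

abbreviation solution :: "real \<Rightarrow> real set \<Rightarrow> (real \<Rightarrow> real) \<Rightarrow> bool" where
  "solution x0 \<equiv> ivp_solution (funnel \<phi>) (closed_loop G \<eta> \<phi> p) x0"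

lemma solution_funnel: "solution x0 I x \<Longrightarrow> t \<in> I \<Longrightarrow> \<phi> t * \<bar>x t\<bar> < 1"
  by (auto simp: ivp_solution_def funnel_def)

lemma solution_deriv:
  "solution x0 I x \<Longrightarrow> t \<in> I \<Longrightarrow>
    (x has_real_derivative closed_loop G \<eta> \<phi> p (t, x t)) (at t within I)"
  by (simp add: ivp_solution_def)

text \<open>Near time 0, where no barrier is available, \<open>\<phi> * \<bar>x\<bar>\<close>
  attains a maximum \<open>w < 1\<close> on the compact interval \<open>{0..a}\<close>. Taking
  \<open>s > w / (1 - w)\<close> puts the level above \<open>w\<close>, and the barrier takes over
  from \<open>a\<close> on.\<close>

lemma solution_level:
  assumes sol: "solution x0 I x"
  obtains a s where "a \<in> I" "0 < a" "0 < s" "\<And>t. t \<in> I \<Longrightarrow> \<phi> t * \<bar>x t\<bar> \<le> s / (1 + s)"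
proof -
  have I: "is_interval I" "0 \<in> I" "I \<subseteq> {0..}" "I \<noteq> {0}" and contx: "continuous_on I x"
    using sol by (auto simp: ivp_solution_def initial_interval_def)
  obtain a where "a \<in> I" "a \<noteq> 0"
    using I by auto
  then have a: "a \<in> I" "0 < a"
    using I by force+
  have sub: "{u..v} \<subseteq> I" if "u \<in> I" "v \<in> I" for u v
    using mem_is_interval_1_I[OF I(1) that] by auto
  have "continuous_on {0..a} (\<lambda>t. \<phi> t * \<bar>x t\<bar>)"
    using sub[OF I(2) a(1)]
    by (intro continuous_intros continuous_on_subset[OF cont_phi] continuous_on_subset[OF contx]) auto
  then obtain t1 where t1: "t1 \<in> {0..a}" "\<And>t. t \<in> {0..a} \<Longrightarrow> \<phi> t * \<bar>x t\<bar> \<le> \<phi> t1 * \<bar>x t1\<bar>"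
    using continuous_attains_sup[of "{0..a}" "\<lambda>t. \<phi> t * \<bar>x t\<bar>"] a(2)
    by (metis atLeastatMost_empty_iff compact_Icc less_le_not_le)
  define w where "w = \<phi> t1 * \<bar>x t1\<bar>"
  have w: "0 \<le> w" "w < 1"
    using t1 phi_nonneg[of t1] solution_funnel[OF sol, of t1] sub[OF I(2) a(1)]
    by (auto simp: w_def)
  obtain s where s: "w / (1 - w) < s" "0 < s"
    and barrier: "\<And>b x D t. \<lbrakk>\<And>t. t \<in> {a..b} \<Longrightarrow> (x has_real_derivative D t) (at t within {a..b});
        \<And>t. t \<in> {a..b} \<Longrightarrow> \<phi> t * \<bar>x t\<bar> = s / (1 + s) \<Longrightarrow> D t = closed_loop G \<eta> \<phi> p (t, x t);
        \<phi> a * \<bar>x a\<bar> < s / (1 + s); t \<in> {a..b}\<rbrakk> \<Longrightarrow> \<phi> t * \<bar>x t\<bar> < s / (1 + s)"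
    using funnel_barrier[OF a(2), of "w / (1 - w)"] by blast
  have small: "\<phi> t * \<bar>x t\<bar> < s / (1 + s)" if "t \<in> {0..a}" for t
    using t1(2)[OF that] less_level[OF w s(1)] by (simp add: w_def)
  have "\<phi> t * \<bar>x t\<bar> \<le> s / (1 + s)" if t: "t \<in> I" for t
  proof (cases "t \<le> a")
    case True
    then show ?thesis
      using small[of t] t I by force
  next
    case False
    have "\<phi> t * \<bar>x t\<bar> < s / (1 + s)"
    proof (rule barrier[of t x "\<lambda>t. closed_loop G \<eta> \<phi> p (t, x t)" t])
      fix r assume "r \<in> {a..t}"
      then show "(x has_real_derivative closed_loop G \<eta> \<phi> p (r, x r)) (at r within {a..t})"
        using solution_deriv[OF sol] sub[OF a(1) t] by (meson DERIV_subset subsetD)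
    qed (use small[of a] a False in auto)
    then show ?thesis
      by simp
  qed
  then show ?thesis
    using that a s by blast
qed

text \<open>The \<open>max 0\<close> extends the right-hand side to negative times, where \<open>p\<close> and \<open>\<phi>\<close> are
  arbitrary.\<close>

definition clipped_loop :: "real \<Rightarrow> real \<Rightarrow> real \<times> real \<Rightarrow> real" where
  "clipped_loop R s = (\<lambda>(t, \<xi>).
     G (p (max 0 t), clip R \<xi>, - \<eta> * gain (clip (s / (1 + s)) (\<phi> (max 0 t) * \<xi>))))"

text \<open>The clipping level is less than 1, so the denominator of the gain never
  vanishes.\<close>

lemma continuous_on_clipped_loop:
  assumes "0 < s"
  shows "continuous_on UNIV (clipped_loop R s)"
proof -
  have "1 - \<bar>clip (s / (1 + s)) w\<bar> \<noteq> 0" for w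
  proof -
    have "\<bar>clip (s / (1 + s)) w\<bar> \<le> s / (1 + s)" "s / (1 + s) < 1"
      using assms by (auto intro: abs_clip_le)
    then show ?thesis
      by linarith
  qed
  then show ?thesis
    unfolding clipped_loop_def case_prod_unfold gain_def
    by (intro continuous_on_compose2[OF contG] continuous_intros continuous_on_compose2[OF contp]
        continuous_on_compose2[OF cont_phi]) auto
qed

text \<open>All arguments passed to \<open>G\<close> lie in a compact box: \<open>p\<close> is
  bounded, the state is clipped, and a clipped level bounds the gain by \<open>s\<close>.\<close>

lemma clipped_loop_bounded:
  assumes "0 < s" "0 \<le> R"
  obtains M where "\<And>z. \<bar>clipped_loop R s z\<bar> \<le> M"
proof -
  obtain P where P: "\<And>t. 0 \<le> t \<Longrightarrow> \<bar>p t\<bar> \<le> P"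
    using bddp bounded_iff by (metis atLeast_iff imageI real_norm_def)
  define K where "K = {-P..P} \<times> {-R..R} \<times> {-s..s}"
  have "compact (G ` K)"
    unfolding K_def
    by (intro compact_continuous_image compact_Times compact_Icc continuous_on_subset[OF contG]) auto
  then obtain M where M: "\<And>k. k \<in> K \<Longrightarrow> \<bar>G k\<bar> \<le> M"
    using compact_imp_bounded bounded_iff by (metis imageI real_norm_def)
  have "\<bar>clipped_loop R s (t, \<xi>)\<bar> \<le> M" for t \<xi>
  proof -
    define g where "g = gain (clip (s / (1 + s)) (\<phi> (max 0 t) * \<xi>))"
    have "\<bar>g\<bar> \<le> s"
      unfolding g_def using assms by (intro abs_gain_le abs_clip_le) auto
    then have "\<bar>- \<eta> * g\<bar> \<le> s"
      using eta by (simp add: abs_mult)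
    then have "- \<eta> * g \<in> {-s..s}"
      by (auto simp: abs_le_iff)
    moreover have "p (max 0 t) \<in> {-P..P}" "clip R \<xi> \<in> {-R..R}"
      using P[of "max 0 t"] abs_clip_le[OF assms(2), of \<xi>] by (auto simp: abs_le_iff)
    ultimately have "(p (max 0 t), clip R \<xi>, - \<eta> * g) \<in> K"
      unfolding K_def by blast
    then show ?thesis
      using M by (simp add: clipped_loop_def g_def)
  qed
  then show ?thesis
    using that by (metis surj_pair)
qed

lemma clipped_loop_eq:
  assumes "0 \<le> t" "\<bar>\<xi>\<bar> \<le> R" "\<phi> t * \<bar>\<xi>\<bar> \<le> s / (1 + s)"
  shows "clipped_loop R s (t, \<xi>) = closed_loop G \<eta> \<phi> p (t, \<xi>)"
  using assms phi_nonneg[of t]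
  by (simp add: clipped_loop_def closed_loop_def clip_eq funnel_gain_eq abs_mult)

lemma clipped_loop_solution:
  assumes "0 < s" "0 \<le> R"
  obtains x where "x a = xa"
    "\<And>t. a \<le> t \<Longrightarrow> (x has_real_derivative clipped_loop R s (t, x t)) (at t within {a..})"
proof -
  obtain M where "\<And>z. \<bar>clipped_loop R s z\<bar> \<le> M"
    using clipped_loop_bounded assms by blast
  from peano_bounded[OF continuous_on_clipped_loop[OF assms(1)] this] show ?thesis
    using that by blast
qed

section \<open>Existence and continuation of solutions\<close>

text \<open>With \<open>s = 1\<close> the clipping level is 1/2. Since \<open>\<phi> 0 = 0\<close>
  and \<open>\<bar>x0\<bar> < R\<close>, the initial point lies strictly inside both clipping
  bounds, so by continuity the clipping is inactive for a short time.\<close>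

lemma local_solution: "\<exists>I x. solution x0 I x"
proof -
  define R where "R = \<bar>x0\<bar> + 1"
  obtain x where x0: "x 0 = x0"
    and der: "\<And>t. 0 \<le> t \<Longrightarrow> (x has_real_derivative clipped_loop R 1 (t, x t)) (at t within {0..})"
    using clipped_loop_solution[of 1 R 0 x0] by (auto simp: R_def)
  have contx: "continuous_on {0..} x"
    by (rule DERIV_continuous_on, rule der) simp
  have "continuous_on {0..} (\<lambda>t. \<bar>x t\<bar>)" "continuous_on {0..} (\<lambda>t. \<phi> t * \<bar>x t\<bar>)"
    by (intro continuous_intros contx cont_phi)+
  then have lim: "((\<lambda>t. \<bar>x t\<bar>) \<longlongrightarrow> \<bar>x 0\<bar>) (at 0 within {0..})"
      "((\<lambda>t. \<phi> t * \<bar>x t\<bar>) \<longlongrightarrow> \<phi> 0 * \<bar>x 0\<bar>) (at 0 within {0..})"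
    by (auto simp: continuous_on_def)
  have "\<forall>\<^sub>F t in at 0 within {0..}. \<bar>x t\<bar> < R" "\<forall>\<^sub>F t in at 0 within {0..}. \<phi> t * \<bar>x t\<bar> < 1 / 2"
    using order_tendstoD(2)[OF lim(1), of R] order_tendstoD(2)[OF lim(2), of "1 / 2"]
    by (simp_all add: R_def x0 phi_0)
  then have "\<forall>\<^sub>F t in at 0 within {0..}. \<bar>x t\<bar> < R \<and> \<phi> t * \<bar>x t\<bar> < 1 / 2"
    by eventually_elim simp
  then obtain d where d: "0 < d"
      "\<And>t. 0 < t \<Longrightarrow> t < d \<Longrightarrow> \<bar>x t\<bar> < R \<and> \<phi> t * \<bar>x t\<bar> < 1 / 2"
    by (auto simp: eventually_at dist_real_def)
  have in_range: "\<bar>x t\<bar> \<le> R \<and> \<phi> t * \<bar>x t\<bar> \<le> 1 / 2" if "t \<in> {0..d / 2}" for t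
    using d(2)[of t] that d(1) x0 phi_0 by (cases "t = 0") (auto simp: R_def)
  have "solution x0 {0..d / 2} x"
    unfolding ivp_solution_def initial_interval_def
  proof (intro conjI ballI)
    show "continuous_on {0..d / 2} x"
      by (rule continuous_on_subset[OF contx]) auto
    show "{0..d / 2} \<noteq> {0}"
      using d(1) by (auto dest: equalityD1)
    show "(\<lambda>t. (t, x t)) ` {0..d / 2} \<subseteq> funnel \<phi>"
      using in_range by (fastforce simp: funnel_def)
    fix t assume t: "t \<in> {0..d / 2}"
    then have "(x has_real_derivative clipped_loop R 1 (t, x t)) (at t within {0..d / 2})"
      using DERIV_subset[OF der[of t]] by auto
    then show "(x has_real_derivative closed_loop G \<eta> \<phi> p (t, x t)) (at t within {0..d / 2})"
      using clipped_loop_eq[of t "x t" R 1] in_range[OF t] t by simp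
  qed (use x0 d(1) is_interval_cc in auto)
  then show ?thesis
    by blast
qed

text \<open>A global solution of the clipped equation is started at \<open>(T, x T)\<close>. The
  barrier from \<open>T\<close> on keeps it below its clipping level, so it solves the closed loop,
  and the two pieces are glued.\<close>

lemma solution_extend_closed:
  assumes sol: "solution x0 {0..T} x" and T: "0 < T"
  obtains y where "solution x0 {0..} y" "\<And>t. t \<in> {0..T} \<Longrightarrow> y t = x t"
proof -
  define w where "w = \<phi> T * \<bar>x T\<bar>"
  have w: "0 \<le> w" "w < 1"
    using solution_funnel[OF sol, of T] phi_nonneg[of T] T by (auto simp: w_def)
  obtain s where s: "w / (1 - w) < s" "0 < s"
    and barrier: "\<And>b x D t. \<lbrakk>\<And>t. t \<in> {T..b} \<Longrightarrow> (x has_real_derivative D t) (at t within {T..b});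
        \<And>t. t \<in> {T..b} \<Longrightarrow> \<phi> t * \<bar>x t\<bar> = s / (1 + s) \<Longrightarrow> D t = closed_loop G \<eta> \<phi> p (t, x t);
        \<phi> T * \<bar>x T\<bar> < s / (1 + s); t \<in> {T..b}\<rbrakk> \<Longrightarrow> \<phi> t * \<bar>x t\<bar> < s / (1 + s)"
    using funnel_barrier[OF T, of "w / (1 - w)"] by blast
  \<comment> \<open>As \<open>\<phi> t \<ge> \<phi> T\<close> from \<open>T\<close> on, staying
    inside the level implies \<open>\<bar>z t\<bar> \<le> 1 / \<phi> T\<close>, and the state
    clipping is inactive too.\<close>
  define R where "R = 1 / \<phi> T"
  have phiT: "0 < \<phi> T"
    using phi_pos T by simp
  obtain z where zT: "z T = x T"
    and der: "\<And>t. T \<le> t \<Longrightarrow> (z has_real_derivative clipped_loop R s (t, z t)) (at t within {T..})"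
    using clipped_loop_solution[OF s(2), of R T "x T"] phiT by (auto simp: R_def)
  have level: "s / (1 + s) < 1"
    using s by simp
  have eq: "clipped_loop R s (t, z t) = closed_loop G \<eta> \<phi> p (t, z t)"
    if "T \<le> t" "\<phi> t * \<bar>z t\<bar> \<le> s / (1 + s)" for t
  proof (rule clipped_loop_eq)
    have "\<phi> T * \<bar>z t\<bar> \<le> \<phi> t * \<bar>z t\<bar>"
      using phi_mono[of T t] T that by (intro mult_right_mono) auto
    then have "\<phi> T * \<bar>z t\<bar> \<le> 1"
      using that level by linarith
    then show "\<bar>z t\<bar> \<le> R"
      using phiT by (simp add: R_def field_simps)
  qed (use that T in auto)
  have inside: "\<phi> t * \<bar>z t\<bar> < s / (1 + s)" if "T \<le> t" for t
  proof (rule barrier[of t z "\<lambda>t. clipped_loop R s (t, z t)" t])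
    fix r assume "r \<in> {T..t}"
    then show "(z has_real_derivative clipped_loop R s (r, z r)) (at r within {T..t})"
      using DERIV_subset[OF der[of r]] by auto
  next
    show "\<phi> T * \<bar>z T\<bar> < s / (1 + s)"
      using less_level[OF w s(1)] zT by (simp add: w_def)
  qed (use eq that in auto)
  have der_z: "(z has_real_derivative closed_loop G \<eta> \<phi> p (t, z t)) (at t within {T..})" if "T \<le> t" for t
    using der[OF that] eq[OF that] inside[OF that] by simp
  define y where "y = (\<lambda>t. if t \<le> T then x t else z t)"
  have der_y: "(y has_real_derivative closed_loop G \<eta> \<phi> p (t, y t)) (at t within {0..})" if "0 \<le> t" for t
    by (rule has_real_derivative_glue[OF _ zT[symmetric] _ der_z y_def that])
      (use T solution_deriv[OF sol] in auto)
  have "solution x0 {0..} y"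
    unfolding ivp_solution_def initial_interval_def
  proof (intro conjI ballI)
    show "continuous_on {0..} y"
      by (rule DERIV_continuous_on, rule der_y) simp
    show "y 0 = x0"
      using sol T by (simp add: y_def ivp_solution_def)
    show "{0..} \<noteq> {0::real}"
      by (metis T atLeast_iff less_eq_real_def less_irrefl singletonD)
    show "(\<lambda>t. (t, y t)) ` {0..} \<subseteq> funnel \<phi>"
    proof clarsimp
      fix t :: real assume t: "0 \<le> t"
      have "\<phi> t * \<bar>y t\<bar> < 1"
      proof (cases "t \<le> T")
        case True
        then show ?thesis
          using solution_funnel[OF sol, of t] t by (simp add: y_def)
      next
        case False
        then show ?thesis
          using inside[of t] level by (simp add: y_def)
      qed
      then show "(t, y t) \<in> funnel \<phi>"
        using t by (simp add: funnel_def)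
    qed
  qed (use der_y in \<open>auto simp: is_interval_1\<close>)
  then show ?thesis
    using that by (auto simp: y_def)
qed

text \<open>The given solution also solves a clipped equation with bounded right-hand side, so it is
  Lipschitz and extends continuously to \<open>T\<close>. The level bound passes to the limit, and
  \<open>s / (1 + s) < 1\<close> keeps the endpoint in the open funnel.\<close>

lemma solution_extend_to_endpoint:
  assumes sol: "solution x0 {0..<T} x"
  obtains y where "solution x0 {0..T} y" "\<And>t. t \<in> {0..<T} \<Longrightarrow> y t = x t"
proof -
  have T: "0 < T" and contx: "continuous_on {0..<T} x" and x0: "x 0 = x0"
    using sol by (auto simp: ivp_solution_def initial_interval_def)
  obtain a s where a: "a \<in> {0..<T}" "0 < a" and s: "0 < s"
    and level: "\<And>t. t \<in> {0..<T} \<Longrightarrow> \<phi> t * \<bar>x t\<bar> \<le> s / (1 + s)"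
    using solution_level[OF sol] by blast
  have "compact (x ` {0..a})"
    by (intro compact_continuous_image continuous_on_subset[OF contx]) (use a in auto)
  then obtain r where r: "\<And>t. t \<in> {0..a} \<Longrightarrow> \<bar>x t\<bar> \<le> r"
    using compact_imp_bounded bounded_iff by (metis imageI real_norm_def)
  \<comment> \<open>Compactness bounds \<open>x\<close> by \<open>r\<close> on
    \<open>{0..a}\<close>, while the funnel gives the bound \<open>1 / \<phi> a\<close>
    afterwards.\<close>
  define R where "R = max r (1 / \<phi> a)"
  have phia: "0 < \<phi> a"
    using phi_pos a by simp
  have level1: "s / (1 + s) < 1"
    using s by simp
  have x_le: "\<bar>x t\<bar> \<le> R" if t: "t \<in> {0..<T}" for t
  proof (cases "t \<le> a")
    case True
    then show ?thesis
      using r[of t] t by (simp add: R_def)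
  next
    case False
    have "\<phi> a * \<bar>x t\<bar> \<le> \<phi> t * \<bar>x t\<bar>"
      using phi_mono[of a t] a False by (intro mult_right_mono) auto
    then have "\<phi> a * \<bar>x t\<bar> \<le> 1"
      using level[OF t] level1 by linarith
    then have "\<bar>x t\<bar> \<le> 1 / \<phi> a"
      using phia by (simp add: field_simps)
    then show ?thesis
      by (simp add: R_def)
  qed
  have "0 \<le> R"
    using phia by (simp add: R_def le_max_iff_disj)
  then obtain M where M: "\<And>z. \<bar>clipped_loop R s z\<bar> \<le> M"
    using clipped_loop_bounded[OF s] by blast
  have der: "(x has_real_derivative clipped_loop R s (t, x t)) (at t within {0..<T})"
    if "t \<in> {0..<T}" for t
    using solution_deriv[OF sol that] clipped_loop_eq[OF _ x_le[OF that] level[OF that]] that by simp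
  have "M-lipschitz_on {0..<T} x"
  proof (rule lipschitz_onI)
    show "0 \<le> M"
      using M[of 0] by linarith
    fix u v assume uv: "u \<in> {0..<T}" "v \<in> {0..<T}"
    show "dist (x u) (x v) \<le> M * dist u v"
      using field_differentiable_bound[OF _ der _ uv] M by (simp add: dist_norm)
  qed
  then obtain y where lip: "M-lipschitz_on (closure {0..<T}) y"
    and yx: "\<And>t. t \<in> {0..<T} \<Longrightarrow> y t = x t"
    using lipschitz_extend_closure by blast
  have clos: "closure {0..<T} = {0..T}"
    using T by simp
  have conty: "continuous_on {0..T} y"
    using lipschitz_on_continuous_on[OF lip] clos by simp
  have y_le: "\<bar>y t\<bar> \<le> R" if "t \<in> {0..T}" for t
  proof (rule continuous_le_on_closure[where S = "{0..<T}" and f = "\<lambda>t. \<bar>y t\<bar>"])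
    show "continuous_on (closure {0..<T}) (\<lambda>t. \<bar>y t\<bar>)"
      unfolding clos by (intro continuous_intros conty)
  qed (use that clos x_le yx in auto)
  have "continuous_on {0..T} (\<lambda>t. \<phi> t * \<bar>y t\<bar>)"
    by (intro continuous_intros conty continuous_on_subset[OF cont_phi]) auto
  then have cont_level: "continuous_on (closure {0..<T}) (\<lambda>t. \<phi> t * \<bar>y t\<bar>)"
    unfolding clos .
  have y_level: "\<phi> t * \<bar>y t\<bar> \<le> s / (1 + s)" if t: "t \<in> {0..T}" for t
  proof (rule continuous_le_on_closure[OF cont_level])
    show "t \<in> closure {0..<T}"
      unfolding clos by (rule t)
    fix r assume "r \<in> {0..<T}"
    then show "\<phi> r * \<bar>y r\<bar> \<le> s / (1 + s)"
      using level[of r] yx[of r] by simp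
  qed
  have der_y: "(y has_real_derivative clipped_loop R s (t, y t)) (at t within {0..T})"
    if "t \<in> {0..T}" for t
  proof (rule has_real_derivative_Icc[OF T _ conty _ that])
    show "continuous_on {0..T} (\<lambda>t. clipped_loop R s (t, y t))"
      by (intro continuous_on_compose2[OF continuous_on_clipped_loop[OF s]] continuous_intros conty) auto
    fix t assume t: "0 < t" "t < T"
    then have "(y has_real_derivative clipped_loop R s (t, y t)) (at t within {0..<T})"
      using has_real_derivative_cong_on[OF _ yx der] yx[of t] by simp
    moreover have "at t within {0..<T} = at t"
      by (rule at_within_interior) (use t in simp)
    ultimately show "(y has_real_derivative clipped_loop R s (t, y t)) (at t)"
      by simp
  qed
  have "solution x0 {0..T} y"
    unfolding ivp_solution_def initial_interval_def
  proof (intro conjI ballI)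
    show "y 0 = x0"
      using yx[of 0] x0 T by simp
    show "{0..T} \<noteq> {0}"
      using T by (auto dest: equalityD1)
    show "(\<lambda>t. (t, y t)) ` {0..T} \<subseteq> funnel \<phi>"
      using order.strict_trans1[OF y_level level1] by (auto simp: funnel_def)
    fix t assume t: "t \<in> {0..T}"
    then show "(y has_real_derivative closed_loop G \<eta> \<phi> p (t, y t)) (at t within {0..T})"
      using der_y[OF t] clipped_loop_eq[OF _ y_le[OF t] y_level[OF t]] by simp
  qed (use T conty is_interval_cc in auto)
  then show ?thesis
    using that yx by blast
qed

text \<open>An interval \<open>I\<close> that is not already \<open>{0..}\<close> is
  \<open>{0..T}\<close> or \<open>{0..<T}\<close> with \<open>T = Sup I\<close>; the half-open case
  is first closed up at \<open>T\<close>.\<close>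

lemma solution_extend:
  assumes sol: "solution x0 I x"
  shows "\<exists>y. solution x0 {0..} y \<and> (\<forall>t\<in>I. y t = x t)"
proof -
  have I: "is_interval I" "0 \<in> I" "I \<subseteq> {0..}" "I \<noteq> {0}"
    using sol by (auto simp: ivp_solution_def initial_interval_def)
  obtain a where a: "a \<in> I" "0 < a"
    using solution_level[OF sol] by blast
  have sub: "t \<in> I" if "0 \<le> t" "t \<le> v" "v \<in> I" for t v
    using mem_is_interval_1_I[OF I(1) I(2) that(3)] that by blast
  show ?thesis
  proof (cases "bdd_above I")
    case False
    have "t \<in> I" if t: "0 \<le> t" for t
    proof -
      obtain v where "v \<in> I" "t < v"
        using False unfolding bdd_above_def by (meson not_le)
      then show ?thesis
        using sub[of t v] t by simp
    qed
    then have "I = {0..}"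
      using I(3) by auto
    then show ?thesis
      using sol by blast
  next
    case True
    define T where "T = Sup I"
    have le: "t \<le> T" if "t \<in> I" for t
      unfolding T_def using that True by (rule cSup_upper)
    have T: "0 < T"
      using le[OF a(1)] a by simp
    have lt: "t \<in> I" if t: "0 \<le> t" "t < T" for t
    proof -
      obtain v where "v \<in> I" "t < v"
        using less_cSupD[of I t] I(2) t(2) by (auto simp: T_def)
      then show ?thesis
        using sub[of t v] t by simp
    qed
    show ?thesis
    proof (cases "T \<in> I")
      case True
      have "I = {0..T}"
        using le sub[of _ T] True I(3) by auto
      then obtain y where "solution x0 {0..} y" "\<And>t. t \<in> I \<Longrightarrow> y t = x t"
        using solution_extend_closed[of x0 T x] sol T by blast
      then show ?thesis
        by blast
    next
      case False
      have "I = {0..<T}"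
        using le lt False I(3) by (force simp: less_le)
      then obtain z where z: "solution x0 {0..T} z" "\<And>t. t \<in> I \<Longrightarrow> z t = x t"
        using solution_extend_to_endpoint[of x0 T x] sol by blast
      moreover obtain y where "solution x0 {0..} y" "\<And>t. t \<in> {0..T} \<Longrightarrow> y t = z t"
        using solution_extend_closed[OF z(1) T] by blast
      moreover have "I \<subseteq> {0..T}"
        using le I(3) by auto
      ultimately show ?thesis
        by (metis subsetD)
    qed
  qed
qed

section \<open>Convergence to 0 and boundedness of the control\<close>

lemma global_solution_tendsto_0:
  assumes sol: "solution x0 {0..} x"
  shows "(x \<longlongrightarrow> 0) at_top"
proof (rule Lim_null_comparison)
  show "\<forall>\<^sub>F t in at_top. norm (x t) \<le> inverse (\<phi> t)"
    using eventually_gt_at_top[of 0]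
  proof eventually_elim
    case (elim t)
    then show ?case
      using solution_funnel[OF sol, of t] phi_pos[of t] by (simp add: field_simps)
  qed
  show "((\<lambda>t. inverse (\<phi> t)) \<longlongrightarrow> 0) at_top"
    using tendsto_inverse_0_at_top phi_at_top by blast
qed

lemma solution_control_bounded:
  assumes sol: "solution x0 I x"
  shows "bounded ((\<lambda>t. - \<eta> * funnel_gain \<phi> (t, x t)) ` I)"
proof -
  obtain s where s: "0 < s" and level: "\<And>t. t \<in> I \<Longrightarrow> \<phi> t * \<bar>x t\<bar> \<le> s / (1 + s)"
    using solution_level[OF sol] by blast
  have "\<bar>- \<eta> * funnel_gain \<phi> (t, x t)\<bar> \<le> s" if t: "t \<in> I" for t
  proof -
    have r: "0 \<le> \<phi> t"
      using sol t phi_nonneg by (auto simp: ivp_solution_def initial_interval_def)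
    then have "\<bar>gain (\<phi> t * x t)\<bar> \<le> s"
      using level[OF t] by (intro abs_gain_le[OF s]) (simp add: abs_mult)
    then show ?thesis
      using eta r by (simp add: abs_mult funnel_gain_eq)
  qed
  then show ?thesis
    by (auto simp: bounded_iff)
qed

end

theorem proposition2p1:
  fixes G :: "real \<times> real \<times> real \<Rightarrow> real"
    and \<eta> c x0 :: real
    and \<phi> \<phi>' p :: "real \<Rightarrow> real"
  assumes "continuous_on UNIV G"
    and "\<eta> \<in> {-1, 1}"
    and "control_direction G \<eta>"
    and "bij_betw \<phi> {0..} {0..}"
    and "\<And>t. t \<ge> 0 \<Longrightarrow> (\<phi> has_real_derivative \<phi>' t) (at t within {0..})"
    and "continuous_on {0..} \<phi>'"
    and "c > 0"
    and "\<And>t. t \<ge> 0 \<Longrightarrow> \<phi>' t \<le> c * (1 + \<phi> t)"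
    and "continuous_on {0..} p"
    and "bounded (p ` {0..})"
  shows "(\<exists>I x. ivp_solution (funnel \<phi>) (closed_loop G \<eta> \<phi> p) x0 I x) \<and>
    (\<forall>I x. ivp_solution (funnel \<phi>) (closed_loop G \<eta> \<phi> p) x0 I x \<longrightarrow>
       (\<exists>y. ivp_solution (funnel \<phi>) (closed_loop G \<eta> \<phi> p) x0 {0..} y \<and> (\<forall>t\<in>I. y t = x t))) \<and>
    (\<forall>x. ivp_solution (funnel \<phi>) (closed_loop G \<eta> \<phi> p) x0 {0..} x \<longrightarrow>
       (x \<longlongrightarrow> 0) at_top \<and>
       bounded ((\<lambda>t. - \<eta> * funnel_gain \<phi> (t, x t)) ` {0..}))"
proof -
  interpret funnel_control G \<eta> c \<phi> \<phi>' p
    by unfold_locales (use assms in auto)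
  show ?thesis
    using local_solution[of x0] solution_extend[of x0] global_solution_tendsto_0[of x0]
      solution_control_bounded[of x0] by (intro conjI allI impI)
qed

end
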